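(* Let $n\ge 1$ be an integer, let $\lambda$ be a dominant integral weight of $\mathfrak{sl}(n+1,\mathbb{C})$, and let $V(\lambda)$ be the finite-dimensional irreducible $\mathfrak{sl}(n+1,\mathbb{C})$-module of highest weight $\lambda$. Let $\mathfrak{a}_n\subset \mathfrak{sl}(n+1,\mathbb{C})$ be the $n$-dimensional abelian subalgebra spanned by the simple root vectors $X_{\alpha_{i}}$ with $1\le i\le n$, $i$ even, and $Y_{\alpha_{i}}$ with $1\le i\le n$, $i$ odd. Then the restriction of $V(\lambda)$ to $\mathfrak{a}_n$ is an indecomposable $\mathfrak{a}_n$-module, i.e. $V(\lambda)$ is not the direct sum of two nonzero $\mathfrak{a}_n$-submodules.
   Context: Let $\mathfrak{h}$ be the Cartan subalgebra of diagonal matrices in $\mathfrak{sl}(n+1,\mathbb{C})$, let $\varepsilon_i:\mathfrak{h}\to\mathbb{C}$ be the projection of a diagonal matrix onto its $i$-th entry, and let $\alpha_i=\varepsilon_i-\varepsilon_{i+1}$, $i=1,\dots,n$, be the simple roots in the usual order (the positive root spaces being the strictly upper triangular ones). $X_{\alpha_i}$ and $Y_{\alpha_i}$ are Chevalley generators: $X_{\alpha_i}$ lies in the root space of $\alpha_i$, $Y_{\alpha_i}$ lies in the root space of $-\alpha_i$, and $[X_{\alpha_i},Y_{\alpha_i}]=H_{\alpha_i}\in\mathfrak{h}$ is the simple coroot. A weight $\lambda\in\mathfrak{h}^*$ is dominant integral if every $\lambda(H_{\alpha_i})$ is a nonnegative integer. *)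

theory Defs
  imports Complex_Main "Jordan_Normal_Form.Matrix"
begin

section \<open>The Lie algebra of traceless matrices\<close>

text \<open>
  Throughout, \<open>N = n + 1\<close> is the matrix size.  Rows, columns, the functionals \<open>\<epsilon>\<^sub>i\<close> and the
  simple roots are numbered from 1 as usual, whereas matrix entries are accessed from 0:
  the \<open>i\<close>-th diagonal entry of \<open>H\<close> is \<open>H $$ (i - 1, i - 1)\<close>.
\<close>

definition sl :: "nat \<Rightarrow> complex mat set" where
  "sl N = {x \<in> carrier_mat N N. (\<Sum>i<N. x $$ (i, i)) = 0}"

definition lie_bracket :: "complex mat \<Rightarrow> complex mat \<Rightarrow> complex mat" where
  "lie_bracket x y = x * y - y * x"

definition cartan :: "nat \<Rightarrow> complex mat set" where
  "cartan N = {H \<in> sl N. diagonal_mat H}"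

definition eps :: "nat \<Rightarrow> complex mat \<Rightarrow> complex" where
  "eps i H = H $$ (i - 1, i - 1)"

definition simple_root :: "nat \<Rightarrow> complex mat \<Rightarrow> complex" where
  "simple_root i H = eps i H - eps (i + 1) H"

definition root_space :: "nat \<Rightarrow> (complex mat \<Rightarrow> complex) \<Rightarrow> complex mat set" where
  "root_space N \<alpha> = {x \<in> sl N. \<forall>H\<in>cartan N. lie_bracket H x = \<alpha> H \<cdot>\<^sub>m x}"

text \<open>The coroot \<open>E\<^sub>i\<^sub>,\<^sub>i - E\<^sub>i\<^sub>+\<^sub>1\<^sub>,\<^sub>i\<^sub>+\<^sub>1\<close> of the \<open>i\<close>-th simple root.\<close>

definition simple_coroot :: "nat \<Rightarrow> nat \<Rightarrow> complex mat" where
  "simple_coroot N i =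
     mat N N (\<lambda>(r, c). if r = c then (if r = i - 1 then 1 else if r = i then -1 else 0) else 0)"

text \<open>
  The root spaces are lines, so these conditions determine \<open>X i\<close> up to a nonzero scalar and then
  \<open>Y i\<close> uniquely.
\<close>

definition chevalley_generators ::
  "nat \<Rightarrow> (nat \<Rightarrow> complex mat) \<Rightarrow> (nat \<Rightarrow> complex mat) \<Rightarrow> bool" where
  "chevalley_generators N X Y \<longleftrightarrow>
     (\<forall>i\<in>{1..<N}. X i \<in> root_space N (simple_root i) \<and>
        Y i \<in> root_space N (\<lambda>H. - simple_root i H) \<and>
        lie_bracket (X i) (Y i) = simple_coroot N i)"

text \<open>The sum of the positive root spaces.\<close>

definition strictly_upper :: "nat \<Rightarrow> complex mat set" where
  "strictly_upper N = {x \<in> carrier_mat N N. \<forall>r<N. \<forall>c<N. c \<le> r \<longrightarrow> x $$ (r, c) = 0}"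

text \<open>
  Linear functionals on the Cartan subalgebra are functions on all matrices of which only the
  values on \<open>cartan N\<close> matter.
\<close>

definition is_weight :: "nat \<Rightarrow> (complex mat \<Rightarrow> complex) \<Rightarrow> bool" where
  "is_weight N \<mu> \<longleftrightarrow>
     (\<forall>H\<in>cartan N. \<forall>K\<in>cartan N. \<mu> (H + K) = \<mu> H + \<mu> K) \<and>
     (\<forall>c. \<forall>H\<in>cartan N. \<mu> (c \<cdot>\<^sub>m H) = c * \<mu> H)"

definition dominant_integral :: "nat \<Rightarrow> (complex mat \<Rightarrow> complex) \<Rightarrow> bool" where
  "dominant_integral N \<mu> \<longleftrightarrow>
     is_weight N \<mu> \<and> (\<forall>i\<in>{1..<N}. \<mu> (simple_coroot N i) \<in> \<nat>)"

text \<open>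
  The type of matrices of all sizes is not a vector space, so the linear span of a set of square
  matrices is formed with \<^const>\<open>hull\<close>, as the library does for vector space types.
\<close>

definition mat_subspace :: "nat \<Rightarrow> complex mat set \<Rightarrow> bool" where
  "mat_subspace N U \<longleftrightarrow> U \<subseteq> carrier_mat N N \<and> 0\<^sub>m N N \<in> U \<and>
     (\<forall>x\<in>U. \<forall>y\<in>U. x + y \<in> U) \<and> (\<forall>c. \<forall>x\<in>U. c \<cdot>\<^sub>m x \<in> U)"

definition mat_span :: "nat \<Rightarrow> complex mat set \<Rightarrow> complex mat set" where
  "mat_span N S = mat_subspace N hull S"

definition alternating_subalgebra ::
  "nat \<Rightarrow> (nat \<Rightarrow> complex mat) \<Rightarrow> (nat \<Rightarrow> complex mat) \<Rightarrow> complex mat set" where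
  "alternating_subalgebra N X Y =
     mat_span N ({X i | i. i \<in> {1..<N} \<and> even i} \<union> {Y i | i. i \<in> {1..<N} \<and> odd i})"

section \<open>Modules\<close>

text \<open>The underlying space of the module is the whole type \<open>'v\<close>, with scalar multiplication \<open>scale\<close>.\<close>

locale sl_module = vector_space scale
  for scale :: "complex \<Rightarrow> 'v::ab_group_add \<Rightarrow> 'v" +
  fixes N :: nat and \<rho> :: "complex mat \<Rightarrow> 'v \<Rightarrow> 'v"
  assumes action_linear: "x \<in> sl N \<Longrightarrow> Vector_Spaces.linear scale scale (\<rho> x)"
    and action_add: "x \<in> sl N \<Longrightarrow> y \<in> sl N \<Longrightarrow> \<rho> (x + y) v = \<rho> x v + \<rho> y v"
    and action_smult: "x \<in> sl N \<Longrightarrow> \<rho> (c \<cdot>\<^sub>m x) v = scale c (\<rho> x v)"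
    and action_bracket: "x \<in> sl N \<Longrightarrow> y \<in> sl N \<Longrightarrow>
           \<rho> (lie_bracket x y) v = \<rho> x (\<rho> y v) - \<rho> y (\<rho> x v)"

text \<open>Submodules, irreducibility and indecomposability for the restriction of \<open>\<rho>\<close> to a Lie subalgebra \<open>L\<close>.\<close>

definition lie_submodule ::
  "(complex \<Rightarrow> 'v::ab_group_add \<Rightarrow> 'v) \<Rightarrow> (complex mat \<Rightarrow> 'v \<Rightarrow> 'v) \<Rightarrow> complex mat set \<Rightarrow>
     'v set \<Rightarrow> bool" where
  "lie_submodule scale \<rho> L W \<longleftrightarrow>
     Modules.module.subspace scale W \<and> (\<forall>x\<in>L. \<forall>w\<in>W. \<rho> x w \<in> W)"

definition irreducible_module ::
  "(complex \<Rightarrow> 'v::ab_group_add \<Rightarrow> 'v) \<Rightarrow> (complex mat \<Rightarrow> 'v \<Rightarrow> 'v) \<Rightarrow> complex mat set \<Rightarrow> bool" where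
  "irreducible_module scale \<rho> L \<longleftrightarrow>
     (UNIV :: 'v set) \<noteq> {0} \<and> (\<forall>W. lie_submodule scale \<rho> L W \<longrightarrow> W = {0} \<or> W = UNIV)"

definition indecomposable_module ::
  "(complex \<Rightarrow> 'v::ab_group_add \<Rightarrow> 'v) \<Rightarrow> (complex mat \<Rightarrow> 'v \<Rightarrow> 'v) \<Rightarrow> complex mat set \<Rightarrow> bool" where
  "indecomposable_module scale \<rho> L \<longleftrightarrow>
     \<not> (\<exists>U W. lie_submodule scale \<rho> L U \<and> lie_submodule scale \<rho> L W \<and> U \<noteq> {0} \<and> W \<noteq> {0} \<and>
          U \<inter> W = {0} \<and> {u + w | u w. u \<in> U \<and> w \<in> W} = UNIV)"

definition highest_weight_vector ::
  "(complex \<Rightarrow> 'v::ab_group_add \<Rightarrow> 'v) \<Rightarrow> nat \<Rightarrow> (complex mat \<Rightarrow> 'v \<Rightarrow> 'v) \<Rightarrow>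
     (complex mat \<Rightarrow> complex) \<Rightarrow> 'v \<Rightarrow> bool" where
  "highest_weight_vector scale N \<rho> \<mu> v \<longleftrightarrow> v \<noteq> 0 \<and>
     (\<forall>H\<in>cartan N. \<rho> H v = scale (\<mu> H) v) \<and> (\<forall>x\<in>strictly_upper N. \<rho> x v = 0)"

text \<open>
  These conditions determine \<open>V(\<mu>)\<close> up to isomorphism, so that a statement about \<open>V(\<mu>)\<close> is one about
  every module satisfying them.
\<close>

definition is_irreducible_highest_weight_module ::
  "(complex \<Rightarrow> 'v::ab_group_add \<Rightarrow> 'v) \<Rightarrow> nat \<Rightarrow> (complex mat \<Rightarrow> 'v \<Rightarrow> 'v) \<Rightarrow>
     (complex mat \<Rightarrow> complex) \<Rightarrow> bool" where
  "is_irreducible_highest_weight_module scale N \<rho> \<mu> \<longleftrightarrow>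
     sl_module scale N \<rho> \<and> (\<exists>B. finite_dimensional_vector_space scale B) \<and>
     irreducible_module scale \<rho> (sl N) \<and> (\<exists>v. highest_weight_vector scale N \<rho> \<mu> v)"

end

theory Submission
  imports Defs "HOL-Library.Function_Algebras"
    "HOL-Computational_Algebra.Fundamental_Theorem_Algebra"
begin

text \<open>
  Let \<open>e\<^sub>i\<close> be the chosen root vectors (\<open>X\<^sub>i\<close> for even \<open>i\<close>, \<open>Y\<^sub>i\<close> for odd \<open>i\<close>), let \<open>f\<^sub>i\<close> be the
  opposite ones, and \<open>h\<^sub>i = [e\<^sub>i, f\<^sub>i]\<close>, which is the coroot up to sign.  A decomposition of \<open>V\<close> into two
  submodules for the span of the \<open>e\<^sub>i\<close> is the same as an idempotent in the algebra \<open>A\<close> of linear maps that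
  commute with every \<open>e\<^sub>i\<close>, so it suffices that \<open>0\<close> and \<open>1\<close> are the only idempotents of \<open>A\<close>.

  Every \<open>e\<^sub>i\<close> shifts weights by a fixed amount, so the weight decomposition of \<open>V\<close> grades \<open>A\<close> by
  differences of weights.  The degree 0 part of \<open>A\<close> consists of scalars: an element \<open>Q\<close> of it commutes
  with \<open>e\<^sub>i\<close> and \<open>h\<^sub>i\<close>, that is, it is a highest weight vector of weight 0 in the \<open>sl\<^sub>2\<close>-module
  \<open>End(V)\<close>, hence it is killed by \<open>f\<^sub>i\<close> as well (\<open>weight_preserving_commuting_commutes_f\<close>).  The
  \<open>e\<^sub>i\<close> and \<open>f\<^sub>i\<close> together generate \<open>sl N\<close> (\<open>chevalley_generators_generate\<close>), so Schur's lemma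
  applies to \<open>Q\<close> (\<open>weight_preserving_commuting_scalar\<close>).

  An element of \<open>A\<close> of nonzero degree is nilpotent, because there are finitely many weights.  So a
  product of elements of opposite nonzero degrees is a scalar that is not invertible, hence \<open>0\<close>
  (\<open>opposite_degrees_compose_0\<close>).  Applying elements of nonzero degree one after the other to a weight
  vector therefore never returns to an earlier weight without reaching \<open>0\<close>, and by induction on the
  number of weights that can still be reached an idempotent of \<open>A\<close> equals its degree 0 component
  (\<open>commuting_idempotent_trivial\<close>).  This is a scalar idempotent, so it is \<open>0\<close> or \<open>1\<close>.
\<close>

section \<open>Eigenvectors in finite-dimensional complex vector spaces\<close>

locale complex_fd_space = finite_dimensional_vector_space scale Basis
  for scale :: "complex \<Rightarrow> 'v::ab_group_add \<Rightarrow> 'v" (infixr \<open>*s\<close> 75) and Basis :: "'v set"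
begin

abbreviation lin :: "('v \<Rightarrow> 'v) \<Rightarrow> bool" where
  "lin T \<equiv> Vector_Spaces.linear scale scale T"

sublocale endo: vector_space_pair scale scale
  by unfold_locales

lemma lin_iff:
  "lin T \<longleftrightarrow> (\<forall>u v. T (u + v) = T u + T v) \<and> (\<forall>c v. T (c *s v) = c *s T v)"
  by (simp add: Vector_Spaces.linear_iff vector_space_axioms)

lemma lin_span_closed:
  assumes "lin T" "\<And>s. s \<in> S \<Longrightarrow> T s \<in> span S" "v \<in> span S"
  shows "T v \<in> span S"
proof -
  have "subspace {v. T v \<in> span S}"
    by (auto simp: subspace_def endo.linear_0[OF assms(1)] endo.linear_add[OF assms(1)]
        endo.linear_scale[OF assms(1)] span_zero span_add span_scale)
  then have "span S \<subseteq> {v. T v \<in> span S}"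
    by (intro span_minimal) (use assms(2) in auto)
  then show ?thesis using assms(3) by auto
qed

definition poly_apply :: "('v \<Rightarrow> 'v) \<Rightarrow> complex poly \<Rightarrow> 'v \<Rightarrow> 'v" where
  "poly_apply T p v = (\<Sum>k\<le>degree p. coeff p k *s (T ^^ k) v)"

lemma poly_apply_bound:
  assumes "degree p \<le> m"
  shows "poly_apply T p v = (\<Sum>k\<le>m. coeff p k *s (T ^^ k) v)"
  unfolding poly_apply_def using assms
  by (intro sum.mono_neutral_left) (auto simp: coeff_eq_0)

lemma poly_apply_linear_factor:
  assumes "lin T"
  shows "poly_apply T ([:- r, 1:] * q) v = T (poly_apply T q v) - r *s poly_apply T q v"
proof -
  let ?m = "degree q" and ?p = "[:- r, 1:] * q"
  have p: "?p = pCons 0 q - smult r q" by simp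
  have "degree ?p \<le> Suc ?m"
    using degree_mult_le[of "[:- r, 1:]" q] by simp
  then have "poly_apply T ?p v = (\<Sum>k\<le>Suc ?m. coeff ?p k *s (T ^^ k) v)"
    by (rule poly_apply_bound)
  also have "\<dots> = (\<Sum>k\<le>Suc ?m. coeff (pCons 0 q) k *s (T ^^ k) v) -
      (\<Sum>k\<le>Suc ?m. coeff (smult r q) k *s (T ^^ k) v)"
    by (simp only: p coeff_diff scale_left_diff_distrib sum_subtractf)
  also have "(\<Sum>k\<le>Suc ?m. coeff (smult r q) k *s (T ^^ k) v) = r *s poly_apply T q v"
    by (simp add: poly_apply_def scale_sum_right coeff_eq_0)
  also have "(\<Sum>k\<le>Suc ?m. coeff (pCons 0 q) k *s (T ^^ k) v) = T (poly_apply T q v)"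
    by (subst sum.atMost_Suc_shift)
      (simp add: poly_apply_def endo.linear_sum[OF assms] endo.linear_scale[OF assms])
  finally show ?thesis .
qed

text \<open>
  The vectors \<open>v, T v, T\<^sup>2 v, \<dots>\<close> outnumber the dimension, so they are linearly dependent.  The
  iterates with exponent at most \<open>dimension\<close> may fail to be pairwise distinct, in which case a
  difference of two monomials annihilates \<open>v\<close>.
\<close>

lemma exists_annihilating_polynomial:
  "\<exists>p. p \<noteq> 0 \<and> poly_apply T p v = 0"
proof (cases "inj_on (\<lambda>k. (T ^^ k) v) {..dimension}")
  case True
  let ?S = "(\<lambda>k. (T ^^ k) v) ` {..dimension}"
  have "card ?S = Suc dimension" using True by (simp add: card_image)
  then have "dependent ?S"
    using independent_card_le_dim[of ?S UNIV] dim_UNIV by (auto simp: dimension_def)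
  then obtain u where u: "\<exists>x\<in>?S. u x \<noteq> 0" "(\<Sum>x\<in>?S. u x *s x) = 0"
    by (auto simp: dependent_finite)
  define p where "p = (\<Sum>k\<le>dimension. monom (u ((T ^^ k) v)) k)"
  have c: "coeff p k = (if k \<le> dimension then u ((T ^^ k) v) else 0)" for k
    by (simp add: p_def coeff_sum)
  have "degree p \<le> dimension" by (rule degree_le) (simp add: c)
  then have "poly_apply T p v = (\<Sum>k\<le>dimension. u ((T ^^ k) v) *s (T ^^ k) v)"
    by (simp add: poly_apply_bound c)
  also have "\<dots> = 0" using u(2) by (simp add: sum.reindex[OF True])
  finally have "poly_apply T p v = 0" .
  moreover obtain k where "k \<le> dimension" "u ((T ^^ k) v) \<noteq> 0" using u(1) by auto
  then have "coeff p k \<noteq> 0" by (simp add: c)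
  then have "p \<noteq> 0" by auto
  ultimately show ?thesis by blast
next
  case False
  then obtain i' j' where "i' \<noteq> j'" "(T ^^ i') v = (T ^^ j') v"
    unfolding inj_on_def by blast
  then obtain i j where ij: "i < j" "(T ^^ i) v = (T ^^ j) v"
    by (cases "i' < j'") (auto dest: le_neq_implies_less simp: not_less)
  define p :: "complex poly" where "p = monom 1 j - monom 1 i"
  have "coeff p j = 1" using ij by (simp add: p_def)
  then have "p \<noteq> 0" by auto
  have "degree p \<le> j"
    using ij(1) by (intro degree_le) (simp add: p_def)
  then have "poly_apply T p v = (\<Sum>k\<le>j. coeff p k *s (T ^^ k) v)" by (rule poly_apply_bound)
  also have "\<dots> = (\<Sum>k\<le>j. (if k = j then (T ^^ k) v else 0) - (if k = i then (T ^^ k) v else 0))"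
    by (rule sum.cong) (auto simp: p_def scale_left_diff_distrib)
  also have "\<dots> = 0" using ij by (simp add: sum_subtractf)
  finally have "poly_apply T p v = 0" .
  with \<open>p \<noteq> 0\<close> show ?thesis by blast
qed

text \<open>
  Take an annihilating polynomial and split off a linear factor \<open>x - r\<close>.  Either the cofactor still
  annihilates \<open>v\<close> and has smaller degree, or applying it to \<open>v\<close> gives an eigenvector for \<open>r\<close>.
\<close>

lemma exists_eigenvector:
  fixes v :: 'v
  assumes "lin T" "v \<noteq> 0"
  shows "\<exists>c u. u \<noteq> 0 \<and> T u = c *s u"
proof -
  have "\<exists>c u. u \<noteq> 0 \<and> T u = c *s u" if "p \<noteq> 0" "poly_apply T p v = 0" for p
    using that
  proof (induction "degree p" arbitrary: p rule: less_induct)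
    case less
    have "degree p \<noteq> 0"
    proof
      assume "degree p = 0"
      then have "coeff p 0 *s v = 0" using less.prems by (simp add: poly_apply_def)
      then show False using less.prems \<open>degree p = 0\<close> \<open>v \<noteq> 0\<close>
        using leading_coeff_0_iff[of p] by simp
    qed
    then have "\<not> constant (poly p)" by (simp add: constant_degree)
    then obtain r where "poly p r = 0" using fundamental_theorem_of_algebra by blast
    then obtain q where q: "p = [:- r, 1:] * q" by (auto simp: poly_eq_0_iff_dvd dvd_def)
    show ?case
    proof (cases "poly_apply T q v = 0")
      case True
      have "q \<noteq> 0" using less.prems q by auto
      moreover have "degree p = Suc (degree q)"
        unfolding q using \<open>q \<noteq> 0\<close> by (subst degree_mult_eq) auto
      ultimately show ?thesis using less.hyps[of q] True by simp
    next
      case False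
      moreover have "T (poly_apply T q v) = r *s poly_apply T q v"
        using less.prems(2) poly_apply_linear_factor[OF assms(1), of r q v] q by simp
      ultimately show ?thesis by blast
    qed
  qed
  then show ?thesis using exists_annihilating_polynomial by blast
qed

end

section \<open>Families of \<open>sl\<^sub>2\<close>-triples and their weight spaces\<close>

text \<open>
  The setting of the main argument: \<open>sl\<^sub>2\<close>-triples \<open>(e i, h i, f i)\<close> of operators such that every
  \<open>e i\<close> and \<open>f i\<close> is a simultaneous eigenvector for the brackets with all \<open>h j\<close>.  As some of the
  \<open>e i\<close> are going to be positive and others negative root vectors, the bracket of \<open>e i\<close> with \<open>f j\<close> for
  \<open>i \<noteq> j\<close> is left open.  The irreducibility concerns all \<open>e i\<close> and \<open>f i\<close> together.
\<close>

locale sl2_triples = complex_fd_space scale Basis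
  for scale :: "complex \<Rightarrow> 'v::ab_group_add \<Rightarrow> 'v" (infixr \<open>*s\<close> 75) and Basis :: "'v set" +
  fixes e f h :: "'i \<Rightarrow> 'v \<Rightarrow> 'v" and a :: "'i \<Rightarrow> 'i \<Rightarrow> complex"
  assumes lin_e: "lin (e i)"
    and lin_f: "lin (f i)"
    and lin_h: "lin (h i)"
    and e_f: "e i (f i v) - f i (e i v) = h i v"
    and h_e: "h j (e i v) - e i (h j v) = a j i *s e i v"
    and h_f: "h j (f i v) - f i (h j v) = - a j i *s f i v"
    and a_diag: "a i i = 2"
    and irreducible: "\<lbrakk>subspace W; \<And>i w. w \<in> W \<Longrightarrow> e i w \<in> W; \<And>i w. w \<in> W \<Longrightarrow> f i w \<in> W\<rbrakk>
      \<Longrightarrow> W = {0} \<or> W = UNIV"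
    and exists_weight_vector: "\<exists>v w. v \<noteq> 0 \<and> (\<forall>i. h i v = w i *s v)"
begin

definition weight_space :: "('i \<Rightarrow> complex) \<Rightarrow> 'v set" where
  "weight_space w = {v. \<forall>i. h i v = w i *s v}"

definition root :: "'i \<Rightarrow> 'i \<Rightarrow> complex" where
  "root i = (\<lambda>j. a j i)"

lemma subspace_weight_space: "subspace (weight_space w)"
  by (auto simp: subspace_def weight_space_def endo.linear_0[OF lin_h] endo.linear_add[OF lin_h]
      endo.linear_scale[OF lin_h] scale_right_distrib scale_left_commute)

lemma e_weight_space: "v \<in> weight_space w \<Longrightarrow> e i v \<in> weight_space (w + root i)"
proof -
  assume v: "v \<in> weight_space w"
  have "h j (e i v) = (w j + a j i) *s e i v" for j
  proof -
    have "h j (e i v) = e i (h j v) + a j i *s e i v" by (simp add: h_e[symmetric])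
    then show ?thesis using v
      by (simp add: weight_space_def endo.linear_scale[OF lin_e] scale_left_distrib)
  qed
  then show ?thesis by (simp add: weight_space_def root_def)
qed

lemma f_weight_space: "v \<in> weight_space w \<Longrightarrow> f i v \<in> weight_space (w - root i)"
proof -
  assume v: "v \<in> weight_space w"
  have "h j (f i v) = (w j - a j i) *s f i v" for j
  proof -
    have "h j (f i v) = f i (h j v) - a j i *s f i v"
      using h_f[of j i v] by (simp add: algebra_simps)
    then show ?thesis using v
      by (simp add: weight_space_def endo.linear_scale[OF lin_f] scale_left_diff_distrib)
  qed
  then show ?thesis by (simp add: weight_space_def root_def)
qed

lemma nonzero_weight_vector: "\<exists>v w. v \<noteq> 0 \<and> v \<in> weight_space w"
  using exists_weight_vector by (simp add: weight_space_def)

text \<open>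
  The span of the weight vectors is stable under all \<open>e i\<close> and \<open>f i\<close>, so irreducibility makes it the
  whole space as soon as there is one weight vector.
\<close>

lemma span_weight_vectors: "span (\<Union>w. weight_space w) = UNIV"
proof -
  let ?S = "\<Union>w. weight_space w"
  have "span ?S = {0} \<or> span ?S = UNIV"
  proof (rule irreducible)
    show "subspace (span ?S)" by simp
    fix i w assume w: "w \<in> span ?S"
    show "e i w \<in> span ?S"
      by (rule lin_span_closed[OF lin_e _ w]) (use e_weight_space in \<open>blast intro: span_base\<close>)
    show "f i w \<in> span ?S"
      by (rule lin_span_closed[OF lin_f _ w]) (use f_weight_space in \<open>blast intro: span_base\<close>)
  qed
  moreover obtain v w where "v \<noteq> 0" "v \<in> weight_space w" using nonzero_weight_vector by blast
  then have "v \<in> span ?S" by (blast intro: span_base)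
  ultimately show ?thesis using \<open>v \<noteq> 0\<close> by blast
qed

lemma lin_eqI:
  assumes "lin S" "lin T" "\<And>w v. v \<in> weight_space w \<Longrightarrow> S v = T v"
  shows "S v = T v"
  by (rule endo.linear_eq_on[OF assms(1,2), of _ "\<Union>w. weight_space w"])
    (use assms(3) span_weight_vectors in auto)

definition weight_basis :: "'v set" where
  "weight_basis = (SOME B. B \<subseteq> (\<Union>w. weight_space w) \<and> independent B \<and> span B = UNIV)"

definition basis_weight :: "'v \<Rightarrow> 'i \<Rightarrow> complex" where
  "basis_weight b = (SOME w. b \<in> weight_space w)"

definition weights :: "('i \<Rightarrow> complex) set" where
  "weights = basis_weight ` weight_basis"

abbreviation coord :: "'v \<Rightarrow> 'v \<Rightarrow> complex" where
  "coord \<equiv> representation weight_basis"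

lemma weight_basis:
  "weight_basis \<subseteq> (\<Union>w. weight_space w)" "independent weight_basis" "span weight_basis = UNIV"
proof -
  let ?P = "\<lambda>B. B \<subseteq> (\<Union>w. weight_space w) \<and> independent B \<and> span B = UNIV"
  obtain B where "B \<subseteq> (\<Union>w. weight_space w)" "independent B" "(\<Union>w. weight_space w) \<subseteq> span B"
    by (rule maximal_independent_subset)
  moreover from \<open>_ \<subseteq> span B\<close> have "span B = UNIV"
    by (metis span_weight_vectors span_minimal subspace_span top.extremum_uniqueI)
  ultimately have "?P B" by blast
  then have "?P weight_basis" unfolding weight_basis_def by (rule someI[where P = ?P])
  then show "weight_basis \<subseteq> (\<Union>w. weight_space w)" "independent weight_basis"
    "span weight_basis = UNIV" by auto
qed

lemma finite_weight_basis: "finite weight_basis"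
  by (rule finiteI_independent[OF weight_basis(2)])

lemma finite_weights: "finite weights"
  by (simp add: weights_def finite_weight_basis)

lemma basis_weight: "b \<in> weight_basis \<Longrightarrow> b \<in> weight_space (basis_weight b)"
  using weight_basis(1) someI[of "\<lambda>w. b \<in> weight_space w"]
  by (auto simp: basis_weight_def)

lemma sum_coord: "(\<Sum>b\<in>weight_basis. coord v b *s b) = v"
  by (rule sum_representation_eq) (simp_all add: weight_basis finite_weight_basis)

text \<open>
  Comparing the coordinates of \<open>h i v\<close> and \<open>w i *s v\<close> for a weight vector \<open>v\<close> shows that only basis
  vectors of the same weight occur in it.  In particular the weight spaces form a direct sum.
\<close>

lemma coord_weight_vector:
  assumes "v \<in> weight_space w" "b \<in> weight_basis" "coord v b \<noteq> 0"
  shows "basis_weight b = w"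
proof
  fix i
  have "h i v = h i (\<Sum>b\<in>weight_basis. coord v b *s b)" by (simp add: sum_coord)
  also have "\<dots> = (\<Sum>b\<in>weight_basis. (coord v b * basis_weight b i) *s b)"
    by (simp add: endo.linear_sum[OF lin_h] endo.linear_scale[OF lin_h])
      (use basis_weight in \<open>auto simp: weight_space_def intro!: sum.cong\<close>)
  finally have "h i v = (\<Sum>b\<in>weight_basis. (coord v b * basis_weight b i) *s b)" .
  moreover have "h i v = w i *s (\<Sum>b\<in>weight_basis. coord v b *s b)"
    using assms(1) by (simp add: sum_coord weight_space_def)
  ultimately have "(\<Sum>b\<in>weight_basis. (coord v b * (basis_weight b i - w i)) *s b) = 0"
    by (simp add: scale_sum_right right_diff_distrib scale_left_diff_distrib sum_subtractf
        mult.commute)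
  then have "coord v b * (basis_weight b i - w i) = 0"
    using independentD[OF weight_basis(2) finite_weight_basis subset_refl] assms(2) by fast
  then show "basis_weight b i = w i" using assms(3) by simp
qed

definition proj :: "('i \<Rightarrow> complex) \<Rightarrow> 'v \<Rightarrow> 'v" where
  "proj w v = (\<Sum>b | b \<in> weight_basis \<and> basis_weight b = w. coord v b *s b)"

lemma lin_proj: "lin (proj w)"
  unfolding lin_iff proj_def
  by (simp add: representation_add representation_scale weight_basis scale_left_distrib
      sum.distrib scale_sum_right)

lemma proj_in_weight_space: "proj w v \<in> weight_space w"
  unfolding proj_def
  by (intro subspace_sum subspace_weight_space subspace_scale) (use basis_weight in auto)

lemma sum_proj: "(\<Sum>w\<in>weights. proj w v) = v"
proof -
  have "(\<Sum>w\<in>weights. proj w v) = (\<Sum>b\<in>weight_basis. coord v b *s b)"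
    unfolding proj_def weights_def
    by (rule sum.group) (simp_all add: finite_weight_basis)
  then show ?thesis by (simp add: sum_coord)
qed

lemma proj_weight_vector:
  assumes "v \<in> weight_space w"
  shows "proj w' v = (if w' = w then v else 0)"
proof (cases "w' = w")
  case True
  have "proj w v = (\<Sum>b\<in>weight_basis. coord v b *s b)"
    unfolding proj_def
    by (rule sum.mono_neutral_left)
      (use coord_weight_vector[OF assms] finite_weight_basis in auto)
  then show ?thesis using True by (simp add: sum_coord)
next
  case False
  then show ?thesis unfolding proj_def
    using coord_weight_vector[OF assms] by (auto intro!: sum.neutral)
qed

lemma weight_of_nonzero:
  assumes "v \<in> weight_space w" "v \<noteq> 0"
  shows "w \<in> weights"
proof (rule ccontr)
  assume "w \<notin> weights"
  then have "(\<Sum>w'\<in>weights. proj w' v) = 0"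
    using proj_weight_vector[OF assms(1)] by (intro sum.neutral) auto
  then show False using sum_proj assms(2) by simp
qed

section \<open>The commutant of the \<open>e i\<close> and its grading\<close>

definition homogeneous :: "('i \<Rightarrow> complex) \<Rightarrow> ('v \<Rightarrow> 'v) \<Rightarrow> bool" where
  "homogeneous d T \<longleftrightarrow> lin T \<and> (\<forall>w. \<forall>v\<in>weight_space w. T v \<in> weight_space (w + d))"

definition commuting :: "('v \<Rightarrow> 'v) \<Rightarrow> bool" where
  "commuting T \<longleftrightarrow> lin T \<and> (\<forall>i v. T (e i v) = e i (T v))"

text \<open>
  The component of degree \<open>d\<close> of \<open>T\<close> for the grading of the endomorphisms by weight differences.
\<close>

definition component :: "('i \<Rightarrow> complex) \<Rightarrow> ('v \<Rightarrow> 'v) \<Rightarrow> 'v \<Rightarrow> 'v" where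
  "component d T v = (\<Sum>w\<in>weights. proj (w + d) (T (proj w v)))"

lemma lin_compose: "lin S \<Longrightarrow> lin T \<Longrightarrow> lin (\<lambda>v. S (T v))"
  by (simp add: lin_iff)

lemma lin_component: "lin T \<Longrightarrow> lin (component d T)"
  unfolding component_def
  by (intro endo.linear_compose_sum ballI lin_compose[OF lin_proj lin_compose[OF _ lin_proj]])

lemma component_weight_vector:
  assumes "lin T" "v \<in> weight_space w"
  shows "component d T v = proj (w + d) (T v)"
proof (cases "v = 0")
  case True
  then show ?thesis
    by (simp add: endo.linear_0[OF lin_component] endo.linear_0[OF lin_proj]
        endo.linear_0 assms(1))
next
  case False
  then have "w \<in> weights" using weight_of_nonzero assms(2) by blast
  have "component d T v = (\<Sum>w'\<in>weights. if w' = w then proj (w + d) (T v) else 0)"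
    unfolding component_def
    by (rule sum.cong) (simp_all add: proj_weight_vector[OF assms(2)] endo.linear_0[OF assms(1)]
        endo.linear_0[OF lin_proj])
  then show ?thesis using \<open>w \<in> weights\<close> finite_weights by simp
qed

lemma sum_component:
  assumes "lin T" "v \<in> weight_space w"
  shows "T v = (\<Sum>w'\<in>weights. component (w' - w) T v)"
  by (simp add: component_weight_vector[OF assms] sum_proj)

lemma homogeneous_component: "lin T \<Longrightarrow> homogeneous d (component d T)"
  by (simp add: homogeneous_def lin_component component_weight_vector proj_in_weight_space)

lemma proj_e: "proj (w + root i) (e i v) = e i (proj w v)"
proof (rule lin_eqI[where S = "\<lambda>v. proj (w + root i) (e i v)" and T = "\<lambda>v. e i (proj w v)"])
  fix w' v assume v: "v \<in> weight_space w'"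
  show "proj (w + root i) (e i v) = e i (proj w v)"
    by (simp add: proj_weight_vector[OF v] proj_weight_vector[OF e_weight_space[OF v]]
        endo.linear_0[OF lin_e])
qed (rule lin_compose[OF lin_proj lin_e] lin_compose[OF lin_e lin_proj])+

text \<open>
  Since \<open>e i\<close> is homogeneous, commuting with it can be checked degree by degree.
\<close>

lemma commuting_component:
  assumes "commuting T"
  shows "commuting (component d T)"
proof -
  have T: "lin T" "T (e i v) = e i (T v)" for i v using assms by (auto simp: commuting_def)
  have "component d T (e i v) = e i (component d T v)" for i v
  proof (rule lin_eqI[where S = "\<lambda>v. component d T (e i v)" and T = "\<lambda>v. e i (component d T v)"])
    fix w v assume v: "v \<in> weight_space w"
    have "component d T (e i v) = proj ((w + root i) + d) (e i (T v))"
      by (simp only: component_weight_vector[OF T(1) e_weight_space[OF v]] T(2))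
    also have "(w + root i) + d = (w + d) + root i" by (simp add: add.commute add.left_commute)
    also have "proj ((w + d) + root i) (e i (T v)) = e i (component d T v)"
      by (simp only: proj_e component_weight_vector[OF T(1) v])
    finally show "component d T (e i v) = e i (component d T v)" .
  qed (rule lin_compose[OF lin_component[OF T(1)] lin_e]
      lin_compose[OF lin_e lin_component[OF T(1)]])+
  then show ?thesis using T lin_component by (simp add: commuting_def)
qed

section \<open>The degree 0 part of the commutant consists of scalars\<close>

lemma weight_preserving_commutes_h:
  assumes "homogeneous 0 Q"
  shows "h j (Q v) = Q (h j v)"
proof (rule lin_eqI[where S = "\<lambda>v. h j (Q v)" and T = "\<lambda>v. Q (h j v)"])
  have Q: "lin Q" using assms by (simp add: homogeneous_def)
  show "lin (\<lambda>v. h j (Q v))" "lin (\<lambda>v. Q (h j v))"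
    by (rule lin_compose[OF lin_h Q] lin_compose[OF Q lin_h])+
  fix w v assume v: "v \<in> weight_space w"
  then have "Q v \<in> weight_space w" using assms by (simp add: homogeneous_def)
  then show "h j (Q v) = Q (h j v)"
    using v by (simp add: weight_space_def endo.linear_scale[OF Q])
qed

text \<open>
  The image of \<open>Q\<close> under the \<open>k\<close>-th power of \<open>ad (f i)\<close>.
\<close>

primrec iterated_bracket :: "'i \<Rightarrow> ('v \<Rightarrow> 'v) \<Rightarrow> nat \<Rightarrow> 'v \<Rightarrow> 'v" where
  "iterated_bracket i Q 0 = Q"
| "iterated_bracket i Q (Suc k) =
     (\<lambda>v. f i (iterated_bracket i Q k v) - iterated_bracket i Q k (f i v))"

lemma lin_iterated_bracket: "lin Q \<Longrightarrow> lin (iterated_bracket i Q k)"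
  by (induction k) (simp_all add: lin_iff lin_f[unfolded lin_iff] scale_right_diff_distrib)

lemma h_iterated_bracket:
  assumes "homogeneous 0 Q"
  shows "h j (iterated_bracket i Q k v) - iterated_bracket i Q k (h j v) =
    (- of_nat k * a j i) *s iterated_bracket i Q k v"
proof (induction k arbitrary: v)
  case 0
  then show ?case by (simp add: weight_preserving_commutes_h[OF assms])
next
  case (Suc k)
  let ?L = "iterated_bracket i Q k"
  have L: "lin ?L" using assms by (simp add: homogeneous_def lin_iterated_bracket)
  have hL: "h j (?L u) = ?L (h j u) - (of_nat k * a j i) *s ?L u" for u
    using Suc.IH[of u] by (simp add: algebra_simps)
  have hf: "h j (f i u) = f i (h j u) - a j i *s f i u" for u
    using h_f[of j i u] by (simp add: algebra_simps)
  show ?case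
    by (simp add: hf hL endo.linear_diff[OF lin_h] endo.linear_diff[OF lin_f]
        endo.linear_diff[OF L] endo.linear_scale[OF lin_f] endo.linear_scale[OF L]
        algebra_simps)
qed

text \<open>
  This is the formula \<open>e f\<^sup>m v = m (\<lambda> - m + 1) f\<^sup>m\<^sup>-\<^sup>1 v\<close> for a highest weight vector \<open>v\<close> of weight \<open>\<lambda>\<close>,
  in the \<open>sl\<^sub>2\<close>-module of endomorphisms of the space, for \<open>v = Q\<close>, \<open>\<lambda> = 0\<close> and \<open>m = Suc k\<close>.
\<close>

lemma e_iterated_bracket:
  assumes "homogeneous 0 Q" "commuting Q"
  shows "e i (iterated_bracket i Q (Suc k) v) - iterated_bracket i Q (Suc k) (e i v) =
    (- of_nat (Suc k * k)) *s iterated_bracket i Q k v"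
proof (induction k arbitrary: v)
  case 0
  have Q: "lin Q" and eQ: "\<And>u. Q (e i u) = e i (Q u)" using assms(2) by (auto simp: commuting_def)
  have ef: "e i (f i u) = f i (e i u) + h i u" for u
    using e_f[of i u] by (simp add: algebra_simps)
  show ?case
    by (simp add: endo.linear_diff[OF lin_e] endo.linear_add[OF Q] ef
        weight_preserving_commutes_h[OF assms(1)] eQ[symmetric])
next
  case (Suc k)
  let ?L = "iterated_bracket i Q (Suc k)" and ?M = "iterated_bracket i Q k"
  have L: "lin ?L" and M: "lin ?M"
    using assms(1) by (simp_all only: homogeneous_def lin_iterated_bracket)
  have ef: "e i (f i u) = f i (e i u) + h i u" for u
    using e_f[of i u] by (simp add: algebra_simps)
  have eL: "e i (?L u) = ?L (e i u) - of_nat (Suc k * k) *s ?M u" for u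
    using Suc.IH[of u] by (simp add: algebra_simps)
  have hL: "h i (?L u) = ?L (h i u) - (2 * of_nat (Suc k)) *s ?L u" for u
    using h_iterated_bracket[OF assms(1), of i i "Suc k" u] a_diag
    by (simp add: algebra_simps del: iterated_bracket.simps of_nat_Suc)
  have "e i (iterated_bracket i Q (Suc (Suc k)) v) = e i (f i (?L v)) - e i (?L (f i v))"
    by (subst iterated_bracket.simps) (simp only: endo.linear_diff[OF lin_e])
  also have "\<dots> = f i (?L (e i v)) - of_nat (Suc k * k) *s f i (?M v) + h i (?L v)
     - (?L (f i (e i v)) + ?L (h i v) - of_nat (Suc k * k) *s ?M (f i v))"
    by (simp only: ef eL endo.linear_add[OF L] endo.linear_diff[OF lin_f]
        endo.linear_scale[OF lin_f])
  also have "\<dots> = iterated_bracket i Q (Suc (Suc k)) (e i v)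
     - of_nat (Suc k * k) *s ?L v - (2 * of_nat (Suc k)) *s ?L v"
    unfolding hL iterated_bracket.simps(2)[of i Q "Suc k"]
    by (simp add: algebra_simps del: of_nat_Suc of_nat_mult)
  also have "of_nat (Suc k * k) *s ?L v = (of_nat (Suc (Suc k) * Suc k) - 2 * of_nat (Suc k)) *s ?L v"
    by (rule arg_cong[where f = "\<lambda>c. c *s ?L v"]) (simp add: algebra_simps)
  finally have "e i (iterated_bracket i Q (Suc (Suc k)) v) = iterated_bracket i Q (Suc (Suc k)) (e i v)
     - (of_nat (Suc (Suc k) * Suc k) - 2 * of_nat (Suc k)) *s ?L v - (2 * of_nat (Suc k)) *s ?L v" .
  moreover have "x - y = - p *s u" if "x = y - (p - q) *s u - q *s u" for x y u p q
    unfolding that by (simp add: scale_left_diff_distrib)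
  ultimately show ?case by blast
qed

text \<open>
  The \<open>m\<close>-th iterated bracket lowers the \<open>i\<close>-th entry of every weight by \<open>2 m\<close>, and only finitely
  many numbers are differences of such entries.
\<close>

lemma iterated_bracket_eventually_0:
  assumes "homogeneous 0 Q"
  shows "\<exists>k. \<forall>v. iterated_bracket i Q (Suc k) v = 0"
proof -
  have Q: "lin Q" using assms by (simp add: homogeneous_def)
  let ?F = "(\<lambda>(w, w'). (w i - w' i) / 2) ` (weights \<times> weights)"
  have "finite ((of_nat :: nat \<Rightarrow> complex) -` ?F)"
    by (intro finite_vimageI finite_imageI finite_cartesian_product finite_weights) (simp add: inj_def)
  then have "finite (insert 0 ((of_nat :: nat \<Rightarrow> complex) -` ?F))" by simp
  \<comment> \<open>\<open>0\<close> is excluded because the bracket has to be applied at least once.\<close>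
  then obtain m where m: "m \<notin> insert 0 ((of_nat :: nat \<Rightarrow> complex) -` ?F)"
    using ex_new_if_finite[OF infinite_UNIV_nat] by blast
  let ?L = "iterated_bracket i Q m"
  have L: "lin ?L" by (rule lin_iterated_bracket[OF Q])
  have "?L v = 0" for v
  proof (rule lin_eqI[OF L endo.linear_zero])
    fix w v assume v: "v \<in> weight_space w"
    show "?L v = 0"
    proof (rule ccontr)
      assume nz: "?L v \<noteq> 0"
      then have "v \<noteq> 0" using endo.linear_0[OF L] by auto
      then have w: "w \<in> weights" using v weight_of_nonzero by blast
      have "h j (?L v) = (w j - of_nat m * a j i) *s ?L v" for j
        using h_iterated_bracket[OF assms, of j i m v] v
        by (simp add: weight_space_def endo.linear_scale[OF L] algebra_simps)
      then have "?L v \<in> weight_space (\<lambda>j. w j - of_nat m * a j i)"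
        by (simp add: weight_space_def)
      then have "(\<lambda>j. w j - of_nat m * a j i) \<in> weights" using nz weight_of_nonzero by blast
      with w have "(w i - (w i - of_nat m * a i i)) / 2 \<in> ?F" by force
      then show False using m by (simp add: a_diag)
    qed
  qed
  moreover obtain k where "m = Suc k" using m by (cases m) auto
  ultimately show ?thesis by blast
qed

text \<open>
  In \<open>e_iterated_bracket\<close> the coefficient of the \<open>k\<close>-th iterated bracket is nonzero for \<open>k \<ge> 1\<close>.  So the
  vanishing of a high iterated bracket descends to the first one, which is the commutator of \<open>f i\<close> and \<open>Q\<close>.
\<close>

lemma weight_preserving_commuting_commutes_f:
  assumes "homogeneous 0 Q" "commuting Q"
  shows "Q (f i v) = f i (Q v)"
proof -
  have step: "\<forall>v. iterated_bracket i Q (Suc k) v = 0"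
    if "\<forall>v. iterated_bracket i Q (Suc (Suc k)) v = 0" for k
  proof
    fix v
    have "(- of_nat (Suc (Suc k) * Suc k)) *s iterated_bracket i Q (Suc k) v = 0"
      using e_iterated_bracket[OF assms, of i "Suc k" v] that
      by (simp only: endo.linear_0[OF lin_e]) simp
    moreover have "(- of_nat (Suc (Suc k) * Suc k) :: complex) \<noteq> 0"
      by (simp del: of_nat_mult of_nat_Suc)
    ultimately show "iterated_bracket i Q (Suc k) v = 0" by (simp only: scale_eq_0_iff) simp
  qed
  obtain k where "\<forall>v. iterated_bracket i Q (Suc k) v = 0"
    using iterated_bracket_eventually_0[OF assms(1)] by blast
  then have "\<forall>v. iterated_bracket i Q (Suc 0) v = 0"
    by (induction k) (use step in blast)+
  then show ?thesis by simp
qed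

text \<open>
  Schur's lemma: an eigenspace of \<open>Q\<close> is stable under all \<open>e i\<close> and \<open>f i\<close>.
\<close>

lemma weight_preserving_commuting_scalar:
  assumes "homogeneous 0 Q" "commuting Q"
  shows "\<exists>c. \<forall>v. Q v = c *s v"
proof -
  have Q: "lin Q" using assms by (simp add: commuting_def)
  obtain v0 :: 'v where "v0 \<noteq> 0" using nonzero_weight_vector by blast
  then obtain c u where u: "u \<noteq> 0" "Q u = c *s u" using exists_eigenvector[OF Q] by blast
  let ?W = "{v. Q v = c *s v}"
  have "?W = {0} \<or> ?W = UNIV"
  proof (rule irreducible)
    show "subspace ?W"
      by (auto simp: subspace_def endo.linear_0[OF Q] endo.linear_add[OF Q]
          endo.linear_scale[OF Q] scale_right_distrib scale_left_commute)
    show "e i w \<in> ?W" if "w \<in> ?W" for i w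
      using that assms(2) by (simp add: commuting_def endo.linear_scale[OF lin_e])
    show "f i w \<in> ?W" if "w \<in> ?W" for i w
      using that weight_preserving_commuting_commutes_f[OF assms]
      by (simp add: endo.linear_scale[OF lin_f])
  qed
  then show ?thesis using u by auto
qed

section \<open>Idempotents of the commutant\<close>

text \<open>
  The powers of an injective \<open>T\<close> would carry a weight vector through infinitely many weights.
\<close>

lemma homogeneous_not_injective:
  assumes "homogeneous d T" "d \<noteq> 0"
  shows "\<exists>v. v \<noteq> 0 \<and> T v = 0"
proof (rule ccontr)
  assume "\<not> (\<exists>v. v \<noteq> 0 \<and> T v = 0)"
  then have inj: "T v \<noteq> 0" if "v \<noteq> 0" for v using that by blast
  obtain v w where v: "v \<noteq> 0" "v \<in> weight_space w" using nonzero_weight_vector by blast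
  have "(T ^^ k) v \<noteq> 0 \<and> (T ^^ k) v \<in> weight_space (w + of_nat k * d)" for k
  proof (induction k)
    case (Suc k)
    then have "T ((T ^^ k) v) \<in> weight_space ((w + of_nat k * d) + d)"
      using assms(1) by (simp only: homogeneous_def)
    also have "(w + of_nat k * d) + d = w + of_nat (Suc k) * d" by (simp add: algebra_simps)
    finally show ?case using Suc inj by simp
  qed (use v in \<open>auto simp: weight_space_def\<close>)
  then have "range (\<lambda>k::nat. w + of_nat k * d) \<subseteq> weights" using weight_of_nonzero by blast
  moreover have "inj (\<lambda>k::nat. w + of_nat k * d)"
  proof
    fix k l :: nat assume eq: "w + of_nat k * d = w + of_nat l * d"
    obtain j where "d j \<noteq> 0" using assms(2) by (auto simp: fun_eq_iff)
    moreover have "of_nat k * d j = of_nat l * d j" using fun_cong[OF eq, of j] by simp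
    ultimately show "k = l" by simp
  qed
  ultimately show False
    using finite_weights finite_subset finite_imageD infinite_UNIV_nat by metis
qed

text \<open>
  The product has degree 0, so it is a scalar, and it is not injective because \<open>S\<close> is not.
\<close>

lemma opposite_degrees_compose_0:
  assumes "homogeneous d S" "commuting S" "homogeneous (- d) T" "commuting T" "d \<noteq> 0"
  shows "T (S v) = 0"
proof -
  have "homogeneous 0 (\<lambda>v. T (S v))"
    unfolding homogeneous_def
  proof (intro conjI allI ballI)
    show "lin (\<lambda>v. T (S v))" using assms lin_compose by (simp add: homogeneous_def)
    fix w v assume "v \<in> weight_space w"
    then have "T (S v) \<in> weight_space ((w + d) + - d)"
      using assms(1,3) by (simp only: homogeneous_def)
    then show "T (S v) \<in> weight_space (w + 0)" by simp
  qed
  moreover have "commuting (\<lambda>v. T (S v))"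
    using assms lin_compose by (simp add: commuting_def)
  ultimately obtain c where c: "\<And>v. T (S v) = c *s v"
    using weight_preserving_commuting_scalar by blast
  obtain u where u: "u \<noteq> 0" "S u = 0" using homogeneous_not_injective assms by blast
  have "c *s u = T 0" using c[of u] u by simp
  also have "\<dots> = 0" using assms(4) endo.linear_0 by (simp add: commuting_def)
  finally have "c = 0" using u by simp
  then show ?thesis using c by simp
qed

text \<open>
  The weights other than \<open>w\<close> to which the homogeneous elements of the commutant can move a vector \<open>v\<close> of
  weight \<open>w\<close>.
\<close>

definition reach :: "('i \<Rightarrow> complex) \<Rightarrow> 'v \<Rightarrow> ('i \<Rightarrow> complex) set" where
  "reach w v = {w'. w' \<noteq> w \<and> (\<exists>T. commuting T \<and> homogeneous (w' - w) T \<and> T v \<noteq> 0)}"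

lemma reach_subset_weights:
  assumes "v \<in> weight_space w"
  shows "reach w v \<subseteq> weights"
proof
  fix w' assume "w' \<in> reach w v"
  then obtain T where T: "homogeneous (w' - w) T" "T v \<noteq> 0" by (auto simp: reach_def)
  then have "T v \<in> weight_space (w + (w' - w))" using assms by (simp only: homogeneous_def)
  then show "w' \<in> weights" using T weight_of_nonzero by simp
qed

text \<open>
  A composite of moves is again a move, and it cannot lead back to \<open>w\<close> by \<open>opposite_degrees_compose_0\<close>.
  The weight \<open>w'\<close> itself is reached from \<open>v\<close>, but no longer from \<open>T v\<close>.
\<close>

lemma reach_decreases:
  assumes "v \<in> weight_space w" "commuting T" "homogeneous (w' - w) T" "w' \<noteq> w" "T v \<noteq> 0"
  shows "reach w' (T v) \<subset> reach w v"
proof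
  show "reach w' (T v) \<subseteq> reach w v"
  proof
    fix w'' assume "w'' \<in> reach w' (T v)"
    then obtain S where S: "commuting S" "homogeneous (w'' - w') S" "S (T v) \<noteq> 0" "w'' \<noteq> w'"
      by (auto simp: reach_def)
    have "w'' \<noteq> w"
    proof
      assume "w'' = w"
      then have "homogeneous (- (w' - w)) S" using S by simp
      then show False
        using opposite_degrees_compose_0[OF assms(3,2) _ S(1)] assms(4) S(3) by simp
    qed
    moreover have "commuting (\<lambda>v. S (T v))"
      using S assms lin_compose by (simp add: commuting_def)
    moreover have "homogeneous (w'' - w) (\<lambda>v. S (T v))"
      unfolding homogeneous_def
    proof (intro conjI allI ballI)
      show "lin (\<lambda>v. S (T v))" using S assms lin_compose by (simp add: homogeneous_def)
      fix u v assume "v \<in> weight_space u"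
      then have "S (T v) \<in> weight_space ((u + (w' - w)) + (w'' - w'))"
        using S(2) assms(3) by (simp only: homogeneous_def)
      also have "(u + (w' - w)) + (w'' - w') = u + (w'' - w)" by (simp add: algebra_simps)
      finally show "S (T v) \<in> weight_space (u + (w'' - w))" .
    qed
    ultimately show "w'' \<in> reach w v" using S(3) by (auto simp: reach_def)
  qed
  have "w' \<in> reach w v" using assms by (auto simp: reach_def)
  moreover have "w' \<notin> reach w' (T v)" by (simp add: reach_def)
  ultimately show "reach w' (T v) \<noteq> reach w v" by blast
qed

text \<open>
  Let \<open>c\<close> be the scalar by which the degree 0 component of \<open>P\<close> acts.  For a weight vector \<open>v\<close> write
  \<open>P v = c v + r\<close> with \<open>r\<close> composed of vectors with smaller reach.  By induction \<open>P r = c r\<close>, so idempotency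
  gives \<open>(c - c\<^sup>2) v + (1 - 2 c) r = 0\<close>.  Since \<open>r\<close> has no component of the weight of \<open>v\<close>, both summands
  vanish, which forces \<open>c \<in> {0, 1}\<close> and then \<open>r = 0\<close>.
\<close>

theorem commuting_idempotent_trivial:
  assumes "commuting P" and idem: "\<And>v. P (P v) = P v"
  shows "(\<forall>v. P v = 0) \<or> (\<forall>v. P v = v)"
proof -
  have P: "lin P" using assms(1) by (simp add: commuting_def)
  obtain c where c: "\<And>v. component 0 P v = c *s v"
    using weight_preserving_commuting_scalar[OF homogeneous_component[OF P]
        commuting_component[OF assms(1)]] by blast
  have scalar: "P v = c *s v" if "v \<in> weight_space w" for v w
    using that
  proof (induction "card (reach w v)" arbitrary: v w rule: less_induct)
    case less
    show ?case
    proof (cases "v = 0")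
      case True
      then show ?thesis by (simp add: endo.linear_0[OF P])
    next
      case False
      define r where "r = (\<Sum>w'\<in>weights - {w}. component (w' - w) P v)"
      have "w \<in> weights" using weight_of_nonzero less.prems False by blast
      then have Pv: "P v = c *s v + r"
        unfolding r_def by (subst sum_component[OF P less.prems])
          (simp add: sum.remove[OF finite_weights] c)
      have "P (component (w' - w) P v) = c *s component (w' - w) P v" if "w' \<noteq> w" for w'
      proof (cases "component (w' - w) P v = 0")
        case True
        then show ?thesis by (simp add: endo.linear_0[OF P])
      next
        case nz: False
        let ?u = "component (w' - w) P v"
        have "?u \<in> weight_space (w + (w' - w))"
          using homogeneous_component[OF P] less.prems by (simp only: homogeneous_def)
        then have u: "?u \<in> weight_space w'" by simp
        have "reach w' ?u \<subset> reach w v"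
          by (rule reach_decreases[OF less.prems commuting_component[OF assms(1)]
                homogeneous_component[OF P] that nz])
        then have "card (reach w' ?u) < card (reach w v)"
          using finite_subset[OF reach_subset_weights[OF less.prems] finite_weights]
          by (rule psubset_card_mono[rotated])
        then show ?thesis using less.hyps u by blast
      qed
      then have Pr: "P r = c *s r"
        by (simp add: r_def endo.linear_sum[OF P] scale_sum_right)
      have "proj w r = proj w (P v) - c *s proj w v"
        by (simp add: Pv endo.linear_add[OF lin_proj] endo.linear_scale[OF lin_proj])
      also have "proj w (P v) = c *s v"
        using component_weight_vector[OF P less.prems, of 0] c by simp
      finally have proj_r: "proj w r = 0" by (simp add: proj_weight_vector[OF less.prems])
      have "c *s v + r = c *s (c *s v + r) + c *s r"
        using idem[of v] by (simp add: Pv endo.linear_add[OF P] endo.linear_scale[OF P] Pr)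
      moreover have "(2 * c) *s r = c *s r + c *s r" by (simp flip: scale_left_distrib)
      ultimately have eq: "(c - c * c) *s v + (1 - 2 * c) *s r = 0"
        by (simp add: algebra_simps)
      then have "proj w ((c - c * c) *s v + (1 - 2 * c) *s r) = 0"
        by (simp add: endo.linear_0[OF lin_proj])
      then have "(c - c * c) *s v = 0"
        by (simp add: endo.linear_add[OF lin_proj] endo.linear_scale[OF lin_proj] proj_r
            proj_weight_vector[OF less.prems])
      then have cc: "c - c * c = 0" using False by simp
      have "(1 - 2 * c) *s r = 0" using eq by (simp only: cc scale_zero_left add_0_left)
      moreover have "1 - 2 * c \<noteq> 0"
      proof
        assume "1 - 2 * c = 0"
        moreover have "c = 0 \<or> c = 1" using cc by simp
        ultimately show False by auto
      qed
      ultimately show ?thesis using Pv by simp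
    qed
  qed
  have all: "P v = c *s v" for v
    by (rule lin_eqI[where T = "\<lambda>v. c *s v", OF P _ scalar])
      (simp_all add: lin_iff scale_right_distrib scale_left_commute)
  obtain v :: 'v where v: "v \<noteq> 0" using nonzero_weight_vector by blast
  have "c * c = c" using idem[of v] v by (simp add: all)
  then have "c = 0 \<or> c = 1" by simp
  then show ?thesis using all by auto
qed

text \<open>
  The projection onto \<open>U\<close> along \<open>W\<close> is an idempotent that commutes with every \<open>e i\<close>.
\<close>

lemma no_e_invariant_decomposition:
  assumes "subspace U" "subspace W" "U \<inter> W = {0}" "{u + w | u w. u \<in> U \<and> w \<in> W} = UNIV"
    and eU: "\<And>i u. u \<in> U \<Longrightarrow> e i u \<in> U" and eW: "\<And>i w. w \<in> W \<Longrightarrow> e i w \<in> W"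
  shows "U = {0} \<or> W = {0}"
proof -
  have uniq: "u = u' \<and> w = w'" if "u \<in> U" "w \<in> W" "u' \<in> U" "w' \<in> W" "u + w = u' + w'" for u w u' w'
  proof -
    have "u - u' = w' - w" using that(5) by (simp add: algebra_simps)
    moreover have "u - u' \<in> U" "w' - w \<in> W" using that assms(1,2) subspace_diff by auto
    ultimately have "u - u' \<in> U \<inter> W" "w' - w \<in> U \<inter> W" by auto
    then show ?thesis using assms(3) by auto
  qed
  define P where "P v = (THE u. u \<in> U \<and> (\<exists>w\<in>W. v = u + w))" for v
  have P: "P (u + w) = u" if "u \<in> U" "w \<in> W" for u w
    unfolding P_def by (rule the_equality) (use that uniq in blast)+
  have decomp: "\<exists>u w. u \<in> U \<and> w \<in> W \<and> v = u + w" for v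
    using UNIV_I[of v, folded assms(4)] by blast
  have "P (u + v) = P u + P v" for u v
  proof -
    obtain u1 w1 u2 w2 where *: "u1 \<in> U" "w1 \<in> W" "u = u1 + w1" "u2 \<in> U" "w2 \<in> W" "v = u2 + w2"
      using decomp by metis
    have "P ((u1 + u2) + (w1 + w2)) = u1 + u2"
      using * assms(1,2) by (intro P) (auto simp: subspace_add)
    then show ?thesis using * by (simp add: P algebra_simps)
  qed
  moreover have "P (c *s v) = c *s P v" for c v
  proof -
    obtain u w where *: "u \<in> U" "w \<in> W" "v = u + w" using decomp by metis
    have "P (c *s u + c *s w) = c *s u"
      using * assms(1,2) by (intro P) (auto simp: subspace_scale)
    then show ?thesis using * by (simp add: P scale_right_distrib)
  qed
  moreover have "P (e i v) = e i (P v)" for i v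
  proof -
    obtain u w where *: "u \<in> U" "w \<in> W" "v = u + w" using decomp by metis
    have "P (e i u + e i w) = e i u" using * eU eW by (intro P) auto
    then show ?thesis using * by (simp add: P endo.linear_add[OF lin_e])
  qed
  ultimately have "commuting P" by (simp add: commuting_def lin_iff)
  moreover have PU: "P u = u" if "u \<in> U" for u
    using P[OF that, of 0] subspace_0[OF assms(2)] by simp
  moreover have "P v \<in> U" for v using decomp[of v] P by auto
  ultimately have "(\<forall>v. P v = 0) \<or> (\<forall>v. P v = v)"
    by (intro commuting_idempotent_trivial) auto
  then show ?thesis
  proof
    assume "\<forall>v. P v = 0"
    then have "U \<subseteq> {0}" using PU by auto
    then show ?thesis using subspace_0[OF assms(1)] by auto
  next
    assume 1: "\<forall>v. P v = v"
    have "P w = 0" if "w \<in> W" for w using P[of 0 w] that subspace_0[OF assms(1)] by simp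
    then have "W \<subseteq> {0}" using 1 by auto
    then show ?thesis using subspace_0[OF assms(2)] by auto
  qed
qed

end

section \<open>Generation of \<open>sl N\<close> by Chevalley generators\<close>

definition matrix_unit :: "nat \<Rightarrow> nat \<Rightarrow> nat \<Rightarrow> complex mat" where
  "matrix_unit N r c = mat N N (\<lambda>(i, j). if i = r \<and> j = c then 1 else 0)"

lemma matrix_unit_carrier [simp]: "matrix_unit N r c \<in> carrier_mat N N"
  by (simp add: matrix_unit_def)

lemma matrix_unit_mult:
  assumes "k < N" "l < N"
  shows "matrix_unit N r k * matrix_unit N l c = (if k = l then matrix_unit N r c else 0\<^sub>m N N)"
  using assms
  by (intro eq_matI)
    (auto simp: matrix_unit_def scalar_prod_def if_distrib[of "\<lambda>x. x * _"] cong: if_cong)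

lemma lie_bracket_matrix_unit:
  assumes "r < N" "k < N" "c < N" "r \<noteq> c"
  shows "lie_bracket (matrix_unit N r k) (matrix_unit N k c) = matrix_unit N r c"
  using assms
  by (simp add: lie_bracket_def matrix_unit_mult) (auto intro!: eq_matI simp: matrix_unit_def)

lemma lie_bracket_opposite_matrix_units:
  assumes "r < N" "c < N"
  shows "lie_bracket (matrix_unit N r c) (matrix_unit N c r) =
    matrix_unit N r r - matrix_unit N c c"
  using assms by (simp add: lie_bracket_def matrix_unit_mult)

lemma lie_bracket_diagonal_entry:
  assumes "H \<in> carrier_mat N N" "diagonal_mat H" "x \<in> carrier_mat N N" "r < N" "c < N"
  shows "lie_bracket H x $$ (r, c) = (H $$ (r, r) - H $$ (c, c)) * x $$ (r, c)"
proof -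
  have "(H * x) $$ (r, c) = (\<Sum>k<N. H $$ (r, k) * x $$ (k, c))"
    using assms by (simp add: scalar_prod_def lessThan_atLeast0)
  also have "\<dots> = (\<Sum>k<N. if k = r then H $$ (r, r) * x $$ (r, c) else 0)"
    using assms by (intro sum.cong) (auto simp: diagonal_mat_def)
  finally have 1: "(H * x) $$ (r, c) = H $$ (r, r) * x $$ (r, c)" using assms by simp
  have "(x * H) $$ (r, c) = (\<Sum>k<N. x $$ (r, k) * H $$ (k, c))"
    using assms by (simp add: scalar_prod_def lessThan_atLeast0)
  also have "\<dots> = (\<Sum>k<N. if k = c then x $$ (r, c) * H $$ (c, c) else 0)"
    using assms by (intro sum.cong) (auto simp: diagonal_mat_def)
  finally have 2: "(x * H) $$ (r, c) = x $$ (r, c) * H $$ (c, c)" using assms by simp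
  show ?thesis using assms 1 2 by (simp add: lie_bracket_def algebra_simps)
qed

lemma root_space_entry:
  assumes "x \<in> root_space N \<alpha>" "H \<in> cartan N" "r < N" "c < N" "x $$ (r, c) \<noteq> 0"
  shows "\<alpha> H = H $$ (r, r) - H $$ (c, c)"
proof -
  have x: "x \<in> carrier_mat N N" and H: "H \<in> carrier_mat N N" "diagonal_mat H"
    using assms by (auto simp: root_space_def sl_def cartan_def)
  have "lie_bracket H x = \<alpha> H \<cdot>\<^sub>m x" using assms by (simp add: root_space_def)
  then have "lie_bracket H x $$ (r, c) = \<alpha> H * x $$ (r, c)" using x assms(3,4) by simp
  then have "(H $$ (r, r) - H $$ (c, c)) * x $$ (r, c) = \<alpha> H * x $$ (r, c)"
    by (simp only: lie_bracket_diagonal_entry[OF H x assms(3,4)])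
  then show ?thesis using assms(5) by auto
qed

text \<open>
  The equation says \<open>2\<^sup>r - 2\<^sup>c = 2\<^sup>j - 2\<^sup>j\<^sup>+\<^sup>1\<close>: a difference of powers of two determines both exponents,
  and this makes the diagonal matrix below separate the roots.
\<close>

lemma two_powers_add_power:
  fixes r j c :: nat
  assumes "2 ^ r + 2 ^ j = (2 ^ c :: nat)"
  shows "r = j \<and> c = Suc j"
proof -
  have False if rj: "r < j" and sum: "2 ^ r + 2 ^ j = (2 ^ c :: nat)" for r j
  proof -
    have "(0::nat) < 2 ^ j" by simp
    then have "(2::nat) ^ r < 2 ^ c" using sum by linarith
    then have rc: "r < c" by simp
    obtain p q where pq: "j = r + Suc p" "c = r + Suc q"
      using less_imp_Suc_add[OF rj] less_imp_Suc_add[OF rc] by auto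
    have "2 ^ r * (1 + 2 * 2 ^ p) = (2 ^ r * (2 * 2 ^ q) :: nat)"
      using sum by (simp add: pq power_add algebra_simps)
    moreover have "(2::nat) ^ r \<noteq> 0" by simp
    ultimately have "1 + 2 * 2 ^ p = (2 * 2 ^ q :: nat)" using mult_left_cancel by blast
    then show False by presburger
  qed
  from this[of r j] this[of j r] assms have "r = j"
    by (simp add: add.commute) (meson linorder_neqE_nat)
  then have "(2::nat) ^ c = 2 ^ Suc j" using assms by simp
  then have "c = Suc j" by (simp del: power_Suc)
  with \<open>r = j\<close> show ?thesis by simp
qed

text \<open>
  The matrix with diagonal entries \<open>2\<^sup>r\<close>, made traceless by subtracting a scalar matrix.  No other root
  takes the same value on it as a simple root or its negative does.
\<close>

definition separating_diagonal :: "nat \<Rightarrow> complex mat" where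
  "separating_diagonal N =
     mat N N (\<lambda>(r, c). if r = c then 2 ^ r - (\<Sum>k<N. 2 ^ k) / of_nat N else 0)"

lemma separating_diagonal_in_cartan: "separating_diagonal N \<in> cartan N"
  by (cases "N = 0")
    (auto simp: cartan_def sl_def separating_diagonal_def diagonal_mat_def sum_subtractf)

lemma separating_diagonal_difference:
  "r < N \<Longrightarrow> c < N \<Longrightarrow>
    separating_diagonal N $$ (r, r) - separating_diagonal N $$ (c, c) = 2 ^ r - 2 ^ c"
  by (simp add: separating_diagonal_def)

lemma separating_diagonal_simple_root:
  assumes "r < N" "c < N" "Suc j < N"
    and "separating_diagonal N $$ (r, r) - separating_diagonal N $$ (c, c) =
      simple_root (Suc j) (separating_diagonal N)"
  shows "r = j \<and> c = Suc j"
proof -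
  have "simple_root (Suc j) (separating_diagonal N) = 2 ^ j - 2 ^ Suc j"
    using assms(3) separating_diagonal_difference[of j N "Suc j"]
    by (simp add: simple_root_def eps_def)
  then have "(2::complex) ^ r + 2 ^ j = 2 ^ c"
    using assms(4) separating_diagonal_difference[OF assms(1,2)] by (simp add: algebra_simps)
  then have "of_nat (2 ^ r + 2 ^ j) = (of_nat (2 ^ c) :: complex)" by simp
  then have "(2::nat) ^ r + 2 ^ j = 2 ^ c" by (simp only: of_nat_eq_iff)
  then show ?thesis by (rule two_powers_add_power)
qed

lemma simple_root_space:
  assumes "x \<in> root_space N (simple_root (Suc j))" "Suc j < N"
  shows "x = x $$ (j, Suc j) \<cdot>\<^sub>m matrix_unit N j (Suc j)"
proof (rule eq_matI)
  fix r c assume "r < dim_row (x $$ (j, Suc j) \<cdot>\<^sub>m matrix_unit N j (Suc j))"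
    "c < dim_col (x $$ (j, Suc j) \<cdot>\<^sub>m matrix_unit N j (Suc j))"
  then have rc: "r < N" "c < N" by (simp_all add: matrix_unit_def)
  have "x $$ (r, c) = 0" if "\<not> (r = j \<and> c = Suc j)"
  proof (rule ccontr)
    assume "x $$ (r, c) \<noteq> 0"
    from root_space_entry[OF assms(1) separating_diagonal_in_cartan rc this]
    show False using separating_diagonal_simple_root[OF rc assms(2)] that by simp
  qed
  then show "x $$ (r, c) = (x $$ (j, Suc j) \<cdot>\<^sub>m matrix_unit N j (Suc j)) $$ (r, c)"
    using rc by (auto simp: matrix_unit_def)
qed (use assms in \<open>auto simp: matrix_unit_def root_space_def sl_def\<close>)

lemma negative_simple_root_space:
  assumes "x \<in> root_space N (\<lambda>H. - simple_root (Suc j) H)" "Suc j < N"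
  shows "x = x $$ (Suc j, j) \<cdot>\<^sub>m matrix_unit N (Suc j) j"
proof (rule eq_matI)
  fix r c assume "r < dim_row (x $$ (Suc j, j) \<cdot>\<^sub>m matrix_unit N (Suc j) j)"
    "c < dim_col (x $$ (Suc j, j) \<cdot>\<^sub>m matrix_unit N (Suc j) j)"
  then have rc: "r < N" "c < N" by (simp_all add: matrix_unit_def)
  have "x $$ (r, c) = 0" if "\<not> (r = Suc j \<and> c = j)"
  proof (rule ccontr)
    assume "x $$ (r, c) \<noteq> 0"
    from root_space_entry[OF assms(1) separating_diagonal_in_cartan rc this]
    have "separating_diagonal N $$ (c, c) - separating_diagonal N $$ (r, r) =
        simple_root (Suc j) (separating_diagonal N)"
      by (simp add: algebra_simps)
    then show False using separating_diagonal_simple_root[OF rc(2,1) assms(2)] that by simp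
  qed
  then show "x $$ (r, c) = (x $$ (Suc j, j) \<cdot>\<^sub>m matrix_unit N (Suc j) j) $$ (r, c)"
    using rc by (auto simp: matrix_unit_def)
qed (use assms in \<open>auto simp: matrix_unit_def root_space_def sl_def\<close>)

lemma lie_bracket_0:
  assumes "x \<in> carrier_mat N N"
  shows "lie_bracket (0\<^sub>m N N) x = 0\<^sub>m N N" "lie_bracket x (0\<^sub>m N N) = 0\<^sub>m N N"
  using assms by (simp_all add: lie_bracket_def)

text \<open>
  The root spaces are lines spanned by matrix units, and \<open>X\<close>, \<open>Y\<close> do not vanish as their bracket is the
  coroot.
\<close>

lemma chevalley_generators_matrix_units:
  assumes "chevalley_generators N X Y" "Suc j < N"
  shows "\<exists>s. matrix_unit N j (Suc j) = s \<cdot>\<^sub>m X (Suc j)"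
    and "\<exists>s. matrix_unit N (Suc j) j = s \<cdot>\<^sub>m Y (Suc j)"
proof -
  let ?x = "X (Suc j) $$ (j, Suc j)" and ?y = "Y (Suc j) $$ (Suc j, j)"
  have mem: "X (Suc j) \<in> root_space N (simple_root (Suc j))"
    "Y (Suc j) \<in> root_space N (\<lambda>H. - simple_root (Suc j) H)"
    and br: "lie_bracket (X (Suc j)) (Y (Suc j)) = simple_coroot N (Suc j)"
    using assms by (auto simp: chevalley_generators_def)
  have car: "X (Suc j) \<in> carrier_mat N N" "Y (Suc j) \<in> carrier_mat N N"
    using mem by (auto simp: root_space_def sl_def)
  have X: "X (Suc j) = ?x \<cdot>\<^sub>m matrix_unit N j (Suc j)"
    by (rule simple_root_space[OF mem(1) assms(2)])
  have Y: "Y (Suc j) = ?y \<cdot>\<^sub>m matrix_unit N (Suc j) j"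
    by (rule negative_simple_root_space[OF mem(2) assms(2)])
  have "simple_coroot N (Suc j) $$ (j, j) = 1" using assms(2) by (simp add: simple_coroot_def)
  then have ne: "simple_coroot N (Suc j) \<noteq> 0\<^sub>m N N" using assms(2) by auto
  have zero: "0 \<cdot>\<^sub>m matrix_unit N r c = 0\<^sub>m N N" for r c
    by (rule eq_matI) (auto simp: matrix_unit_def)
  have "?x \<noteq> 0"
  proof
    assume "?x = 0"
    then have "X (Suc j) = 0\<^sub>m N N" using X zero by metis
    then show False using br ne lie_bracket_0(1)[OF car(2)] by simp
  qed
  then have "matrix_unit N j (Suc j) = (1 / ?x) \<cdot>\<^sub>m X (Suc j)"
    by (subst X) (auto intro!: eq_matI simp: matrix_unit_def)
  then show "\<exists>s. matrix_unit N j (Suc j) = s \<cdot>\<^sub>m X (Suc j)" by blast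
  have "?y \<noteq> 0"
  proof
    assume "?y = 0"
    then have "Y (Suc j) = 0\<^sub>m N N" using Y zero by metis
    then show False using br ne lie_bracket_0(2)[OF car(1)] by simp
  qed
  then have "matrix_unit N (Suc j) j = (1 / ?y) \<cdot>\<^sub>m Y (Suc j)"
    by (subst Y) (auto intro!: eq_matI simp: matrix_unit_def)
  then show "\<exists>s. matrix_unit N (Suc j) j = s \<cdot>\<^sub>m Y (Suc j)" by blast
qed

text \<open>
  The type of matrices of all sizes is not an additive monoid, so \<open>x\<close> is not written as a finite sum over its
  entries.  Instead the entries of \<open>x\<close> are cleared one at a time.  The diagonal entries are cleared against the last one,
  which vanishes at the end because the trace does.
\<close>

lemma matrix_units_span_sl:
  assumes zero: "0\<^sub>m N N \<in> K"
    and add: "\<And>x y. x \<in> K \<Longrightarrow> y \<in> K \<Longrightarrow> x + y \<in> K"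
    and smult: "\<And>s x. x \<in> K \<Longrightarrow> s \<cdot>\<^sub>m x \<in> K"
    and off_diagonal: "\<And>r c. r < N \<Longrightarrow> c < N \<Longrightarrow> r \<noteq> c \<Longrightarrow> matrix_unit N r c \<in> K"
    and diagonal: "\<And>r. Suc r < N \<Longrightarrow> matrix_unit N r r - matrix_unit N (N - 1) (N - 1) \<in> K"
  shows "sl N \<subseteq> K"
proof
  fix x assume "x \<in> sl N"
  let ?S = "\<lambda>x :: complex mat. {p \<in> {..<N} \<times> {..<N} - {(N - 1, N - 1)}. x $$ p \<noteq> 0}"
  have fin: "finite (?S x)" for x by simp
  show "x \<in> K" using \<open>x \<in> sl N\<close>
  proof (induction "card (?S x)" arbitrary: x rule: less_induct)
    case less
    have x: "x \<in> carrier_mat N N" "(\<Sum>i<N. x $$ (i, i)) = 0"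
      using less.prems by (auto simp: sl_def)
    show ?case
    proof (cases "?S x = {}")
      case True
      have "x $$ (r, c) = 0" if "r < N" "c < N" for r c
      proof (cases "(r, c) = (N - 1, N - 1)")
        case rc: True
        have "(\<Sum>i<N. x $$ (i, i)) = (\<Sum>i<N. if i = r then x $$ (r, r) else 0)"
          by (rule sum.cong) (use True rc that in auto)
        then show ?thesis using x(2) that rc by simp
      qed (use True that in auto)
      then have "x = 0\<^sub>m N N" using x(1) by (intro eq_matI) auto
      then show ?thesis using zero by simp
    next
      case False
      then obtain r c where rc: "r < N" "c < N" "(r, c) \<noteq> (N - 1, N - 1)" "x $$ (r, c) \<noteq> 0" by auto
      define b where "b = (if r = c then matrix_unit N r r - matrix_unit N (N - 1) (N - 1)
        else matrix_unit N r c)"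
      have "b \<in> K"
      proof (cases "r = c")
        case True
        then have "Suc r < N" using rc by auto
        then show ?thesis using diagonal True by (simp add: b_def)
      qed (use off_diagonal rc in \<open>simp add: b_def\<close>)
      have b: "b \<in> carrier_mat N N" by (simp add: b_def minus_carrier_mat)
      have b_entry: "b $$ p = (if p = (r, c) then 1 else 0)"
        if "p \<in> {..<N} \<times> {..<N} - {(N - 1, N - 1)}" for p
        using that rc by (cases p) (auto simp: b_def matrix_unit_def)
      have tr_unit: "(\<Sum>i<N. matrix_unit N k l $$ (i, i)) = (if k = l then 1 else 0)"
        if "k < N" for k l
      proof -
        have "(\<Sum>i<N. matrix_unit N k l $$ (i, i)) = (\<Sum>i<N. if i = k then (if k = l then 1 else 0) else 0)"
          by (rule sum.cong) (auto simp: matrix_unit_def)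
        then show ?thesis using that by simp
      qed
      have "(\<Sum>i<N. (matrix_unit N r r - matrix_unit N (N - 1) (N - 1)) $$ (i, i)) =
          (\<Sum>i<N. matrix_unit N r r $$ (i, i) - matrix_unit N (N - 1) (N - 1) $$ (i, i))"
        by (rule sum.cong) (auto simp: matrix_unit_def)
      then have tr_b: "(\<Sum>i<N. b $$ (i, i)) = 0"
        using tr_unit rc by (auto simp: b_def sum_subtractf)
      define y where "y = x - x $$ (r, c) \<cdot>\<^sub>m b"
      have y: "y \<in> carrier_mat N N" using x b by (simp add: y_def minus_carrier_mat)
      have y_entry: "y $$ (i, j) = x $$ (i, j) - x $$ (r, c) * b $$ (i, j)" if "i < N" "j < N" for i j
        using that x b by (simp add: y_def)
      have "(\<Sum>i<N. y $$ (i, i)) = 0"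
        using x(2) tr_b by (simp add: y_entry sum_subtractf flip: sum_distrib_left)
      then have ysl: "y \<in> sl N" using y by (simp add: sl_def)
      have "?S y \<subset> ?S x"
      proof
        show "?S y \<subseteq> ?S x" using b_entry y_entry by (auto split: if_splits)
        have "(r, c) \<in> ?S x" "(r, c) \<notin> ?S y" using rc b_entry y_entry by auto
        then show "?S y \<noteq> ?S x" by blast
      qed
      then have "card (?S y) < card (?S x)" using fin by (rule psubset_card_mono[rotated])
      then have "y \<in> K" using less.hyps ysl by blast
      moreover have "x = y + x $$ (r, c) \<cdot>\<^sub>m b"
        using x b by (intro eq_matI) (auto simp: y_def)
      ultimately show ?thesis using add smult \<open>b \<in> K\<close> by metis
    qed
  qed
qed

lemma chevalley_generators_generate:
  assumes chev: "chevalley_generators N X Y" and "2 \<le> N"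
    and add: "\<And>x y. x \<in> K \<Longrightarrow> y \<in> K \<Longrightarrow> x + y \<in> K"
    and smult: "\<And>s x. x \<in> K \<Longrightarrow> s \<cdot>\<^sub>m x \<in> K"
    and bracket: "\<And>x y. x \<in> K \<Longrightarrow> y \<in> K \<Longrightarrow> lie_bracket x y \<in> K"
    and gen: "\<And>i. i \<in> {1..<N} \<Longrightarrow> X i \<in> K" "\<And>i. i \<in> {1..<N} \<Longrightarrow> Y i \<in> K"
  shows "sl N \<subseteq> K"
proof -
  have simple: "matrix_unit N j (Suc j) \<in> K" "matrix_unit N (Suc j) j \<in> K" if "Suc j < N" for j
    using chevalley_generators_matrix_units[OF chev that] gen[of "Suc j"] smult that by auto
  have upper: "matrix_unit N r (r + Suc m) \<in> K" if "r + Suc m < N" for r m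
    using that
  proof (induction m)
    case (Suc m)
    have "matrix_unit N r (r + Suc (Suc m)) =
        lie_bracket (matrix_unit N r (r + Suc m)) (matrix_unit N (r + Suc m) (Suc (r + Suc m)))"
      using Suc.prems by (subst lie_bracket_matrix_unit) auto
    then show ?case using bracket Suc simple(1)[of "r + Suc m"] by simp
  qed (use simple in simp)
  have lower: "matrix_unit N (r + Suc m) r \<in> K" if "r + Suc m < N" for r m
    using that
  proof (induction m)
    case (Suc m)
    have "matrix_unit N (r + Suc (Suc m)) r =
        lie_bracket (matrix_unit N (Suc (r + Suc m)) (r + Suc m)) (matrix_unit N (r + Suc m) r)"
      using Suc.prems by (subst lie_bracket_matrix_unit) auto
    then show ?case using bracket Suc simple(2)[of "r + Suc m"] by simp
  qed (use simple in simp)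
  have off_diagonal: "matrix_unit N r c \<in> K" if "r < N" "c < N" "r \<noteq> c" for r c
  proof (cases "r < c")
    case True
    then obtain m where "c = r + Suc m" using less_imp_Suc_add by auto
    then show ?thesis using upper that by simp
  next
    case False
    then have "c < r" using that by simp
    then obtain m where "r = c + Suc m" using less_imp_Suc_add by auto
    then show ?thesis using lower that by simp
  qed
  show ?thesis
  proof (rule matrix_units_span_sl[OF _ add smult off_diagonal])
    have "0 \<cdot>\<^sub>m matrix_unit N 0 1 \<in> K" using off_diagonal smult \<open>2 \<le> N\<close> by simp
    also have "0 \<cdot>\<^sub>m matrix_unit N 0 1 = 0\<^sub>m N N"
      by (rule eq_matI) (auto simp: matrix_unit_def)
    finally show "0\<^sub>m N N \<in> K" .
    fix r assume "Suc r < N"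
    then show "matrix_unit N r r - matrix_unit N (N - 1) (N - 1) \<in> K"
      using bracket[OF off_diagonal off_diagonal, of r "N - 1" "N - 1" r]
      by (simp add: lie_bracket_opposite_matrix_units)
  qed
qed

lemma simple_coroot_in_cartan:
  assumes "i \<in> {1..<N}"
  shows "simple_coroot N i \<in> cartan N"
proof -
  have "(\<Sum>k<N. simple_coroot N i $$ (k, k)) =
      (\<Sum>k<N. (if k = i - 1 then 1 else 0) - (if k = i then 1 else 0))"
    by (rule sum.cong) (use assms in \<open>auto simp: simple_coroot_def\<close>)
  also have "\<dots> = 0" using assms by (auto simp: sum_subtractf)
  finally show ?thesis by (auto simp: cartan_def sl_def simple_coroot_def diagonal_mat_def)
qed

lemma simple_root_simple_coroot:
  "i \<in> {1..<N} \<Longrightarrow> simple_root i (simple_coroot N i) = 2"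
  by (auto simp: simple_root_def eps_def simple_coroot_def)

text \<open>
  The elements of \<open>sl N\<close> that preserve \<open>W\<close> form a Lie subalgebra.
\<close>

lemma lie_submodule_of_generators:
  assumes "sl_module scale N \<rho>" "chevalley_generators N X Y" "2 \<le> N"
    and sub: "Modules.module.subspace scale W"
    and XW: "\<And>i w. i \<in> {1..<N} \<Longrightarrow> w \<in> W \<Longrightarrow> \<rho> (X i) w \<in> W"
    and YW: "\<And>i w. i \<in> {1..<N} \<Longrightarrow> w \<in> W \<Longrightarrow> \<rho> (Y i) w \<in> W"
  shows "lie_submodule scale \<rho> (sl N) W"
proof -
  interpret sl_module scale N \<rho> by fact
  let ?K = "{x \<in> sl N. \<forall>w\<in>W. \<rho> x w \<in> W}"
  have add_sl: "x + y \<in> sl N" if "x \<in> sl N" "y \<in> sl N" for x y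
    using that by (auto simp: sl_def sum.distrib)
  have smult_sl: "s \<cdot>\<^sub>m x \<in> sl N" if "x \<in> sl N" for s x
    using that by (auto simp: sl_def simp flip: sum_distrib_left)
  have bracket_sl: "lie_bracket x y \<in> sl N" if "x \<in> sl N" "y \<in> sl N" for x y
  proof -
    have xy: "x \<in> carrier_mat N N" "y \<in> carrier_mat N N" using that by (auto simp: sl_def)
    have "(\<Sum>i<N. (x * y) $$ (i, i)) = (\<Sum>i<N. \<Sum>k<N. x $$ (i, k) * y $$ (k, i))"
      using xy by (simp add: scalar_prod_def lessThan_atLeast0)
    also have "\<dots> = (\<Sum>k<N. \<Sum>i<N. y $$ (k, i) * x $$ (i, k))"
      by (subst sum.swap) (simp add: mult.commute)
    also have "\<dots> = (\<Sum>i<N. (y * x) $$ (i, i))"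
      using xy by (simp add: scalar_prod_def lessThan_atLeast0)
    finally show ?thesis using xy by (simp add: lie_bracket_def sl_def sum_subtractf minus_carrier_mat)
  qed
  have "sl N \<subseteq> ?K"
  proof (rule chevalley_generators_generate[OF assms(2,3)])
    show "x + y \<in> ?K" if "x \<in> ?K" "y \<in> ?K" for x y
      using that sub by (simp add: add_sl action_add subspace_add)
    show "s \<cdot>\<^sub>m x \<in> ?K" if "x \<in> ?K" for s x
      using that sub by (simp add: smult_sl action_smult subspace_scale)
    show "lie_bracket x y \<in> ?K" if "x \<in> ?K" "y \<in> ?K" for x y
      using that sub by (simp add: bracket_sl action_bracket subspace_diff)
    show "X i \<in> ?K" "Y i \<in> ?K" if "i \<in> {1..<N}" for i
      using that assms(2) XW YW by (auto simp: chevalley_generators_def root_space_def)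
  qed
  then show ?thesis using sub by (auto simp: lie_submodule_def)
qed

section \<open>Restriction to the alternating subalgebra\<close>

text \<open>
  The module is an instance of \<open>sl2_triples\<close> with index type \<open>nat\<close>, where the indices outside \<open>{1..<N}\<close>
  carry zero operators.  For odd \<open>i\<close> the roles of \<open>X i\<close> and \<open>Y i\<close> are exchanged, which changes the sign of the
  \<open>i\<close>-th coroot; the signs \<open>s\<close> record this.
\<close>

lemma restriction_indecomposable:
  fixes scale :: "complex \<Rightarrow> 'v::ab_group_add \<Rightarrow> 'v"
  assumes "2 \<le> N"
    and "is_irreducible_highest_weight_module scale N \<rho> \<mu>"
    and "chevalley_generators N X Y"
  shows "indecomposable_module scale \<rho> (alternating_subalgebra N X Y)"
proof -
  define R where "R = {1..<N}"
  let ?C = "simple_coroot N"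
  have mod: "sl_module scale N \<rho>" and irr: "irreducible_module scale \<rho> (sl N)"
    using assms(2) by (auto simp: is_irreducible_highest_weight_module_def)
  obtain Basis where Basis: "finite_dimensional_vector_space scale Basis"
    using assms(2) by (auto simp: is_irreducible_highest_weight_module_def)
  obtain v\<^sub>0 where v\<^sub>0: "v\<^sub>0 \<noteq> 0" "\<And>H. H \<in> cartan N \<Longrightarrow> \<rho> H v\<^sub>0 = scale (\<mu> H) v\<^sub>0"
    using assms(2)
    by (auto simp: is_irreducible_highest_weight_module_def highest_weight_vector_def)
  interpret M: sl_module scale N \<rho> by (rule mod)
  interpret F: complex_fd_space scale Basis by (intro complex_fd_space.intro Basis)
  have X: "X i \<in> sl N" and Y: "Y i \<in> sl N" and C: "?C i \<in> sl N"
    and XY: "lie_bracket (X i) (Y i) = ?C i"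
    and HX: "H \<in> cartan N \<Longrightarrow> lie_bracket H (X i) = simple_root i H \<cdot>\<^sub>m X i"
    and HY: "H \<in> cartan N \<Longrightarrow> lie_bracket H (Y i) = (- simple_root i H) \<cdot>\<^sub>m Y i"
    if "i \<in> R" for i H
    using assms(3) that simple_coroot_in_cartan[of i N]
    by (auto simp: chevalley_generators_def root_space_def cartan_def R_def)
  note lin0 = M.action_linear[THEN F.endo.linear_0]
  define s :: "nat \<Rightarrow> complex" where "s i = (if even i then 1 else - 1)" for i
  define e where "e i = (if i \<in> R then \<rho> (if even i then X i else Y i) else (\<lambda>_. 0))" for i
  define f where "f i = (if i \<in> R then \<rho> (if even i then Y i else X i) else (\<lambda>_. 0))" for i
  define h where "h i = (if i \<in> R then (\<lambda>v. scale (s i) (\<rho> (?C i) v)) else (\<lambda>_. 0))" for i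
  \<comment> \<open>The value \<open>2\<close> for \<open>i = j\<close> is right for the zero triples too: their relations hold for any \<open>a i i\<close>.\<close>
  define a where "a j i = (if i = j then 2 else if j \<in> R
    then s j * s i * simple_root i (?C j) else 0)" for j i
  have commX: "\<rho> (?C j) (\<rho> (X i) v) - \<rho> (X i) (\<rho> (?C j) v) = scale (simple_root i (?C j)) (\<rho> (X i) v)"
    and commY: "\<rho> (?C j) (\<rho> (Y i) v) - \<rho> (Y i) (\<rho> (?C j) v) = scale (- simple_root i (?C j)) (\<rho> (Y i) v)"
    if "i \<in> R" "j \<in> R" for i j v
    using that X Y C HX HY simple_coroot_in_cartan[of j N, folded R_def]
    by (simp_all only: M.action_bracket[symmetric] M.action_smult)
  have a_eq: "a j i = s j * s i * simple_root i (?C j)" if "i \<in> R" "j \<in> R" for i j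
    using that simple_root_simple_coroot[of i N, folded R_def] by (auto simp: a_def s_def)
  interpret sl2_triples scale Basis e f h a
  proof (intro sl2_triples.intro sl2_triples_axioms.intro F.complex_fd_space_axioms)
    fix i j v
    show "F.lin (e i)" "F.lin (f i)"
      using M.action_linear X Y F.endo.linear_zero by (simp_all add: e_def f_def)
    show "F.lin (h i)"
    proof (cases "i \<in> R")
      case True
      then show ?thesis using M.action_linear[OF C[OF True]]
        by (simp add: h_def F.endo.linear_compose_scale_right)
    qed (auto simp: h_def F.endo.linear_zero)
    show "e i (f i v) - f i (e i v) = h i v"
    proof (cases "i \<in> R")
      case True
      have "\<rho> (?C i) v = \<rho> (X i) (\<rho> (Y i) v) - \<rho> (Y i) (\<rho> (X i) v)"
        using X Y XY True by (simp only: M.action_bracket[symmetric])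
      then show ?thesis using True by (auto simp: e_def f_def h_def s_def)
    qed (auto simp: e_def f_def h_def)
    show "h j (e i v) - e i (h j v) = scale (a j i) (e i v)"
    proof (cases "i \<in> R \<and> j \<in> R")
      case True
      then have i: "i \<in> R" and j: "j \<in> R" by auto
      have "h j (e i v) - e i (h j v) = scale (s j) (\<rho> (?C j) (e i v) - e i (\<rho> (?C j) v))"
        using i j X Y M.action_linear
        by (simp add: h_def e_def M.scale_right_diff_distrib F.endo.linear_scale)
      also have "\<rho> (?C j) (e i v) - e i (\<rho> (?C j) v) = scale (s i * simple_root i (?C j)) (e i v)"
        using i commX[OF i j] commY[OF i j] by (simp add: e_def s_def)
      finally show ?thesis using a_eq[OF i j] by (simp add: mult.assoc)
    qed (auto simp: e_def h_def a_def lin0 X Y C)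
    show "h j (f i v) - f i (h j v) = scale (- a j i) (f i v)"
    proof (cases "i \<in> R \<and> j \<in> R")
      case True
      then have i: "i \<in> R" and j: "j \<in> R" by auto
      have "h j (f i v) - f i (h j v) = scale (s j) (\<rho> (?C j) (f i v) - f i (\<rho> (?C j) v))"
        using i j X Y M.action_linear
        by (simp add: h_def f_def M.scale_right_diff_distrib F.endo.linear_scale)
      also have "\<rho> (?C j) (f i v) - f i (\<rho> (?C j) v) = scale (- (s i * simple_root i (?C j))) (f i v)"
        using i commX[OF i j] commY[OF i j] by (simp add: f_def s_def)
      finally show ?thesis using a_eq[OF i j] by (simp add: mult.assoc)
    qed (auto simp: f_def h_def a_def lin0 X Y C)
    show "a i i = 2" by (simp add: a_def)
  next
    fix W assume W: "M.subspace W" "\<And>i w. w \<in> W \<Longrightarrow> e i w \<in> W" "\<And>i w. w \<in> W \<Longrightarrow> f i w \<in> W"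
    have "lie_submodule scale \<rho> (sl N) W"
    proof (rule lie_submodule_of_generators[OF mod assms(3) _ W(1)])
      show "2 \<le> N" by fact
      fix i w assume i: "i \<in> {1..<N}" and w: "w \<in> W"
      show "\<rho> (X i) w \<in> W" "\<rho> (Y i) w \<in> W"
        using i W(2)[OF w, of i] W(3)[OF w, of i] by (auto simp: e_def f_def R_def split: if_splits)
    qed
    then show "W = {0} \<or> W = UNIV" using irr by (simp add: irreducible_module_def)
  next
    have "h i v\<^sub>0 = scale (if i \<in> R then s i * \<mu> (?C i) else 0) v\<^sub>0" for i
      using v\<^sub>0(2)[OF simple_coroot_in_cartan] by (simp add: h_def R_def)
    then show "\<exists>v w. v \<noteq> 0 \<and> (\<forall>i. h i v = scale (w i) v)"
      using v\<^sub>0(1) by (intro exI[of _ v\<^sub>0] exI[of _ "\<lambda>i. if i \<in> R then s i * \<mu> (?C i) else 0"]) blast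
  qed
  have e_closed: "e i u \<in> U" if "lie_submodule scale \<rho> (alternating_subalgebra N X Y) U" "u \<in> U" for U i u
  proof (cases "i \<in> R")
    case True
    let ?G = "{X i | i. i \<in> {1..<N} \<and> even i} \<union> {Y i | i. i \<in> {1..<N} \<and> odd i}"
    have "(if even i then X i else Y i) \<in> ?G" using True by (auto simp: R_def)
    then have "(if even i then X i else Y i) \<in> alternating_subalgebra N X Y"
      unfolding alternating_subalgebra_def mat_span_def using hull_subset[of ?G "mat_subspace N"] by blast
    then show ?thesis using that True by (auto simp: lie_submodule_def e_def split: if_splits)
  qed (use that M.subspace_0 in \<open>simp add: e_def lie_submodule_def\<close>)
  show ?thesis
    unfolding indecomposable_module_def
  proof (intro notI, elim exE conjE)
    fix U W
    assume U: "lie_submodule scale \<rho> (alternating_subalgebra N X Y) U" "U \<noteq> {0}"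
      and W: "lie_submodule scale \<rho> (alternating_subalgebra N X Y) W" "W \<noteq> {0}"
      and UW: "U \<inter> W = {0}" "{u + w | u w. u \<in> U \<and> w \<in> W} = UNIV"
    have "U = {0} \<or> W = {0}"
    proof (rule no_e_invariant_decomposition[OF _ _ UW])
      show "M.subspace U" "M.subspace W" using U(1) W(1) by (simp_all add: lie_submodule_def)
    qed (fact e_closed[OF U(1)] e_closed[OF W(1)])+
    then show False using U(2) W(2) by blast
  qed
qed

theorem theorem3p9:
  fixes n :: nat
    and \<mu> :: "complex mat \<Rightarrow> complex"
    and X Y :: "nat \<Rightarrow> complex mat"
    and scale :: "complex \<Rightarrow> 'v::ab_group_add \<Rightarrow> 'v"
    and \<rho> :: "complex mat \<Rightarrow> 'v \<Rightarrow> 'v"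
  assumes "n \<ge> 1"
    and "dominant_integral (n + 1) \<mu>"
    and "is_irreducible_highest_weight_module scale (n + 1) \<rho> \<mu>"
    and "chevalley_generators (n + 1) X Y"
  shows "indecomposable_module scale \<rho> (alternating_subalgebra (n + 1) X Y)"
  by (rule restriction_indecomposable) (use assms in simp_all)

end
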